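(* Let $(X,T)$ be a topological dynamical system and $\mu$ an ergodic ($T$-invariant) Borel probability measure on $X$ such that $(X,\mu)$ is Vitali and satisfies Lebesgue's density theorem. Then $(X,T)$ is $\mu$-sensitive if and only if $X$ contains no $\mu$-equicontinuity points of $(X,T)$.
   Context: $\mathbb{N}=\{1,2,\dots\}$. A topological dynamical system (TDS) is a pair $(X,T)$ where $X$ is a compact metric space with metric $d$ and $T:X\to X$ is continuous. For $x\in X$ and $n\in\mathbb{N}$, $B_n(x)=\{z\in X: d(x,z)\le 1/n\}$. The orbit metric is $d_o(x,y)=\sup_{i\ge 0} d(T^ix,T^iy)$, and the orbit balls are $B^o_m(x)=\{y\in X: d_o(x,y)\le 1/m\}$. A point $x$ is a $\mu$-equicontinuity point of $(X,T)$ if for all $m\in\mathbb{N}$, $\lim_{n\to\infty}\frac{\mu(B^o_m(x)\cap B_n(x))}{\mu(B_n(x))}=1$ (in particular $\mu(B_n(x))>0$ for all $n$). For $\varepsilon>0$ let $S(\varepsilon)=\{(x,y)\in X^2: \exists n>0 \text{ such that } d(T^nx,T^ny)\ge\varepsilon\}$. $(X,T)$ is $\mu$-sensitive (or $\mu$-pairwise sensitive) if there exists $\varepsilon>0$ such that $(\mu\times\mu)(S(\varepsilon))=1$. $(X,\mu)$ satisfies Lebesgue's density theorem if for every Borel set $A\subset X$, $\lim_{n\to\infty}\frac{\mu(A\cap B_n(x))}{\mu(B_n(x))}=1$ for $\mu$-a.e. $x\in A$. $(X,\mu)$ is Vitali if for every Borel set $A\subset X$, every $N\in\mathbb{N}$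 and every $\varepsilon>0$, there exist a finite subset $F\subset A$ and integers $n_x\ge N$ (for $x\in F$) such that the balls $\{B_{n_x}(x)\}_{x\in F}$ are pairwise disjoint and $\mu(A\setminus\bigcup_{x\in F}B_{n_x}(x))\le\varepsilon$. *)

theory Defs
  imports "HOL-Probability.Probability"
begin

text \<open>The phase space is a compact subset \<open>X\<close> of a metric space type, and Borel measures on \<open>X\<close>
  are measures on the subspace \<open>\<sigma>\<close>-algebra \<open>restrict_space borel X\<close>. Balls are relative to \<open>X\<close>.
  The index \<open>0\<close>, for which \<open>1 / real 0 = 0\<close>, is excluded wherever it could matter.\<close>

definition TDS :: "'a::metric_space set \<Rightarrow> ('a \<Rightarrow> 'a) \<Rightarrow> bool" where
  "TDS X T \<longleftrightarrow> compact X \<and> continuous_on X T \<and> T \<in> X \<rightarrow> X"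

definition borel_prob_on :: "'a::metric_space set \<Rightarrow> 'a measure \<Rightarrow> bool" where
  "borel_prob_on X \<mu> \<longleftrightarrow> prob_space \<mu> \<and> sets \<mu> = sets (restrict_space borel X)"

definition ergodic :: "'a measure \<Rightarrow> ('a \<Rightarrow> 'a) \<Rightarrow> bool" where
  "ergodic \<mu> T \<longleftrightarrow>
     T \<in> measurable \<mu> \<mu> \<and>
     (\<forall>A\<in>sets \<mu>. emeasure \<mu> (T -` A \<inter> space \<mu>) = emeasure \<mu> A) \<and>
     (\<forall>A\<in>sets \<mu>. T -` A \<inter> space \<mu> = A \<longrightarrow> measure \<mu> A = 0 \<or> measure \<mu> A = 1)"

definition Bn :: "'a::metric_space set \<Rightarrow> nat \<Rightarrow> 'a \<Rightarrow> 'a set" where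
  "Bn X n x = {z \<in> X. dist x z \<le> 1 / real n}"

text \<open>On a compact \<open>X\<close> the distances are bounded, so the real supremum is the genuine one.\<close>

definition orbit_dist :: "('a::metric_space \<Rightarrow> 'a) \<Rightarrow> 'a \<Rightarrow> 'a \<Rightarrow> real" where
  "orbit_dist T x y = (SUP i. dist ((T ^^ i) x) ((T ^^ i) y))"

definition orbit_ball :: "'a::metric_space set \<Rightarrow> ('a \<Rightarrow> 'a) \<Rightarrow> nat \<Rightarrow> 'a \<Rightarrow> 'a set" where
  "orbit_ball X T m x = {y \<in> X. orbit_dist T x y \<le> 1 / real m}"

definition equicontinuity_point ::
  "'a::metric_space set \<Rightarrow> ('a \<Rightarrow> 'a) \<Rightarrow> 'a measure \<Rightarrow> 'a \<Rightarrow> bool" where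
  "equicontinuity_point X T \<mu> x \<longleftrightarrow>
     x \<in> X \<and>
     (\<forall>n\<ge>1. measure \<mu> (Bn X n x) > 0) \<and>
     (\<forall>m\<ge>1. (\<lambda>n. measure \<mu> (orbit_ball X T m x \<inter> Bn X n x) / measure \<mu> (Bn X n x))
        \<longlonglongrightarrow> 1)"

definition S :: "'a::metric_space set \<Rightarrow> ('a \<Rightarrow> 'a) \<Rightarrow> real \<Rightarrow> ('a \<times> 'a) set" where
  "S X T \<epsilon> = {(x, y) \<in> X \<times> X. \<exists>n>0. dist ((T ^^ n) x) ((T ^^ n) y) \<ge> \<epsilon>}"

definition sensitive :: "'a::metric_space set \<Rightarrow> ('a \<Rightarrow> 'a) \<Rightarrow> 'a measure \<Rightarrow> bool" where
  "sensitive X T \<mu> \<longleftrightarrow> (\<exists>\<epsilon>>0. measure (\<mu> \<Otimes>\<^sub>M \<mu>) (S X T \<epsilon>) = 1)"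

text \<open>Where \<open>\<mu> (Bn X n x) = 0\<close> for some \<open>n \<ge> 1\<close>, the quotient below is eventually \<open>0 / 0 = 0\<close>, so
  the limit condition fails there, as it does for an undefined quotient.\<close>

definition lebesgue_density :: "'a::metric_space set \<Rightarrow> 'a measure \<Rightarrow> bool" where
  "lebesgue_density X \<mu> \<longleftrightarrow>
     (\<forall>A\<in>sets \<mu>. AE x in \<mu>. x \<in> A \<longrightarrow>
        (\<lambda>n. measure \<mu> (A \<inter> Bn X n x) / measure \<mu> (Bn X n x)) \<longlonglongrightarrow> 1)"

definition vitali :: "'a::metric_space set \<Rightarrow> 'a measure \<Rightarrow> bool" where
  "vitali X \<mu> \<longleftrightarrow>
     (\<forall>A\<in>sets \<mu>. \<forall>N\<ge>1. \<forall>\<epsilon>>0. \<exists>F k.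
        finite F \<and> F \<subseteq> A \<and> (\<forall>x\<in>F. k x \<ge> (N::nat)) \<and>
        disjoint_family_on (\<lambda>x. Bn X (k x) x) F \<and>
        measure \<mu> (A - (\<Union>x\<in>F. Bn X (k x) x)) \<le> \<epsilon>)"

end

theory Submission
  imports Defs
begin

text \<open>If \<open>x\<close> is an equicontinuity point, a small orbit ball around \<open>x\<close> has positive measure and its
  square avoids \<open>S X T \<epsilon>\<close>. Conversely, if the system is not sensitive, Fubini's theorem yields
  orbit balls of any radius \<open>r\<close> with positive measure; the set of their centres is mapped into
  itself by \<open>T\<close>, so by ergodicity almost every point is such a centre. A maximal disjoint
  family of these balls is countable, so countably many orbit balls of radius \<open>2 * r\<close> cover
  almost all of \<open>X\<close>. By Lebesgue density almost every point \<open>x\<close> is a density point of a covering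
  ball that contains it, and hence of the orbit ball of radius \<open>4 * r\<close> around \<open>x\<close>.\<close>

section \<open>Disjoint families of sets\<close>

text \<open>Disjointness bounds the number of members of measure above \<open>1 / Suc n\<close> by
  \<open>Suc n\<close> times the total measure, so the index set is a countable union of finite
  sets.\<close>

lemma (in finite_measure) countable_disjoint_positive_measure:
  assumes disj: "disjoint_family_on A I"
    and sets: "\<And>i. i \<in> I \<Longrightarrow> A i \<in> sets M"
    and pos: "\<And>i. i \<in> I \<Longrightarrow> measure M (A i) > 0"
  shows "countable I"
proof -
  define J where "J n = {i \<in> I. measure M (A i) > 1 / real (Suc n)}" for n
  have "finite (J n)" for n
  proof -
    have "card F \<le> nat \<lceil>measure M (space M) * real (Suc n)\<rceil>"
      if F: "F \<subseteq> J n" "finite F" for F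
    proof -
      have FI: "F \<subseteq> I" using F(1) by (auto simp: J_def)
      have "real (card F) * (1 / real (Suc n)) = (\<Sum>i\<in>F. 1 / real (Suc n))"
        by simp
      also have "\<dots> \<le> (\<Sum>i\<in>F. measure M (A i))"
        using F(1) by (intro sum_mono) (auto simp: J_def less_imp_le)
      also have "\<dots> = measure M (\<Union>i\<in>F. A i)"
        using F(2) FI disj sets
        by (intro finite_measure_finite_Union[symmetric]) (auto simp: disjoint_family_on_def)
      also have "\<dots> \<le> measure M (space M)"
        by (rule bounded_measure)
      finally have "real (card F) \<le> measure M (space M) * real (Suc n)"
        by (simp add: field_simps)
      then show ?thesis by linarith
    qed
    then show ?thesis
      using finite_if_finite_subsets_card_bdd by blast
  qed
  moreover have "I = (\<Union>n. J n)"
  proof -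
    have "\<exists>n. 1 / real (Suc n) < measure M (A i)" if "i \<in> I" for i
      using nat_approx_posE[OF pos[OF that]] by metis
    then show ?thesis by (auto simp: J_def)
  qed
  ultimately show ?thesis
    by (metis countable_UN countableI_type countable_finite)
qed

text \<open>Zorn's lemma for the disjoint subfamilies ordered by inclusion: any two indices in the
  union of a chain already lie in a common member of the chain.\<close>

lemma maximal_disjoint_subfamily:
  obtains C where "C \<subseteq> I" "disjoint_family_on A C"
    "\<And>i. i \<in> I \<Longrightarrow> i \<notin> C \<Longrightarrow> \<exists>c\<in>C. A i \<inter> A c \<noteq> {}"
proof -
  let ?F = "{C. C \<subseteq> I \<and> disjoint_family_on A C}"
  have "\<exists>M\<in>?F. \<forall>C\<in>?F. M \<subseteq> C \<longrightarrow> C = M"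
  proof (rule subset_Zorn_nonempty)
    show "?F \<noteq> {}" by (auto simp: disjoint_family_on_def)
  next
    fix \<C> assume ch: "\<C> \<noteq> {}" "subset.chain ?F \<C>"
    have "disjoint_family_on A (\<Union>\<C>)"
      unfolding disjoint_family_on_def
    proof (intro ballI impI)
      fix i j assume ij: "i \<in> \<Union>\<C>" "j \<in> \<Union>\<C>" "i \<noteq> j"
      then obtain C D where "i \<in> C" "C \<in> \<C>" "j \<in> D" "D \<in> \<C>" by blast
      moreover have "C \<subseteq> D \<or> D \<subseteq> C"
        using subset_chain_def ch(2) \<open>C \<in> \<C>\<close> \<open>D \<in> \<C>\<close> by metis
      ultimately obtain E where "E \<in> \<C>" "i \<in> E" "j \<in> E" by blast
      then show "A i \<inter> A j = {}"
        using ch(2) ij(3) by (auto simp: subset.chain_def disjoint_family_on_def subset_iff)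
    qed
    moreover have "\<Union>\<C> \<subseteq> I"
      using ch(2) by (auto simp: subset.chain_def)
    ultimately show "\<Union>\<C> \<in> ?F" by simp
  qed
  then obtain C where C: "C \<subseteq> I" "disjoint_family_on A C"
    and max: "\<And>D. D \<subseteq> I \<Longrightarrow> disjoint_family_on A D \<Longrightarrow> C \<subseteq> D \<Longrightarrow> D = C" by auto
  have "\<exists>c\<in>C. A i \<inter> A c \<noteq> {}" if "i \<in> I" "i \<notin> C" for i
  proof (rule ccontr)
    assume "\<not> ?thesis"
    then have "disjoint_family_on A (insert i C)"
      using C(2) by (auto simp: disjoint_family_on_def Int_commute)
    then show False
      using max[of "insert i C"] C(1) that by blast
  qed
  then show thesis using that C by blast
qed

section \<open>The ergodic system and measurability of the metric\<close>

locale ergodic_system =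
  fixes X :: "'a::metric_space set" and T :: "'a \<Rightarrow> 'a" and \<mu> :: "'a measure"
  assumes TDS: "TDS X T"
    and borel_prob: "borel_prob_on X \<mu>"
    and ergodic: "ergodic \<mu> T"
begin

sublocale prob_space \<mu>
  using borel_prob by (simp add: borel_prob_on_def)

sublocale square: pair_prob_space \<mu> \<mu> ..

lemma compact_X: "compact X" and T_maps: "x \<in> X \<Longrightarrow> T x \<in> X"
  using TDS by (auto simp: TDS_def)

lemma sets_eq: "sets \<mu> = sets (restrict_space borel X)"
  using borel_prob by (simp add: borel_prob_on_def)

lemma space_eq: "space \<mu> = X"
  using sets_eq_imp_space_eq[OF sets_eq] by (simp add: space_restrict_space)

lemma T_measurable [measurable]: "T \<in> measurable \<mu> \<mu>"
  using ergodic by (simp add: ergodic_def)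

lemma measure_vimage_T:
  assumes "A \<in> sets \<mu>" shows "measure \<mu> (T -` A \<inter> X) = measure \<mu> A"
  using ergodic assms by (simp add: ergodic_def measure_def space_eq)

lemma zero_one:
  assumes "A \<in> sets \<mu>" "T -` A \<inter> X = A"
  shows "measure \<mu> A = 0 \<or> measure \<mu> A = 1"
  using ergodic assms by (simp add: ergodic_def space_eq)

lemma funpow_maps: "x \<in> X \<Longrightarrow> (T ^^ i) x \<in> X"
  by (induction i) (auto simp: T_maps)

lemma funpow_measurable [measurable]: "(T ^^ i) \<in> measurable \<mu> \<mu>"
  by (rule measurable_compose_n) (rule T_measurable)

lemma dist_measurable [measurable]: "(\<lambda>y. dist y c) \<in> borel_measurable \<mu>"
proof -
  have "(\<lambda>y. dist y c) \<in> borel_measurable (restrict_space borel X)"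
    by (intro borel_measurable_continuous_on_restrict continuous_intros)
  then show ?thesis
    using measurable_cong_sets[OF sets_eq refl] by blast
qed

text \<open>The type \<open>'a\<close> need not be second countable; a countable dense subset of \<open>X\<close> makes the metric
  jointly measurable on \<open>X\<close>.\<close>

lemma dist_measurable_pair [measurable]:
  "(\<lambda>p. dist (fst p) (snd p)) \<in> borel_measurable (\<mu> \<Otimes>\<^sub>M \<mu>)"
proof -
  have "\<exists>K. finite K \<and> X \<subseteq> (\<Union>c\<in>K. ball c (1 / real (Suc n)))" for n
    using compact_X by (auto simp: compact_eq_totally_bounded)
  then obtain K where K: "\<And>n. finite (K n)" "\<And>n. X \<subseteq> (\<Union>c\<in>K n. ball c (1 / real (Suc n)))"
    by metis
  \<comment> \<open>The points of these finite nets need not lie in \<open>X\<close>;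
    \<open>dist_measurable\<close> accepts any centre \<open>c\<close>.\<close>
  define D where "D = (\<Union>n. K n)"
  have D: "countable D" unfolding D_def by (intro countable_UN countableI_type countable_finite K)
  have dense: "\<exists>c\<in>D. dist c x < e" if x: "x \<in> X" and e: "e > 0" for x e
  proof -
    obtain n where n: "1 / real (Suc n) < e" using nat_approx_posE[OF e] .
    obtain c where "c \<in> K n" "dist c x < 1 / real (Suc n)" using K(2)[of n] x by auto
    then show ?thesis using n by (auto simp: D_def intro: less_trans)
  qed
  \<comment> \<open>Each condition on the right is a sum of functions of a single coordinate, hence
    measurable.\<close>
  have "{p \<in> space (\<mu> \<Otimes>\<^sub>M \<mu>). dist (fst p) (snd p) < r} =
      (\<Union>c\<in>D. {p \<in> space (\<mu> \<Otimes>\<^sub>M \<mu>). dist (fst p) c + dist (snd p) c < r})" (is "?L = ?R") for r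
  proof
    show "?L \<subseteq> ?R"
    proof
      fix p assume p: "p \<in> ?L"
      then have "fst p \<in> X" by (auto simp: space_pair_measure space_eq)
      \<comment> \<open>Half the gap, because the detour through \<open>c\<close> costs
        \<open>dist c (fst p)\<close> twice.\<close>
      moreover have "(r - dist (fst p) (snd p)) / 2 > 0" using p by simp
      ultimately obtain c where c: "c \<in> D" "dist c (fst p) < (r - dist (fst p) (snd p)) / 2"
        using dense by blast
      have "dist (fst p) c + dist (snd p) c < r"
        using c(2) dist_triangle[of "snd p" c "fst p"] by (simp add: dist_commute field_simps)
      then show "p \<in> ?R" using p c(1) by blast
    qed
    show "?R \<subseteq> ?L"
      by (auto intro: le_less_trans[OF dist_triangle2])
  qed
  moreover have "(\<Union>c\<in>D. {p \<in> space (\<mu> \<Otimes>\<^sub>M \<mu>). dist (fst p) c + dist (snd p) c < r})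
      \<in> sets (\<mu> \<Otimes>\<^sub>M \<mu>)" for r
    using D by (intro sets.countable_UN') auto
  ultimately show ?thesis
    by (intro borel_measurableI_less) simp
qed

lemma dist_funpow_measurable_pair [measurable]:
  "(\<lambda>p. dist ((T ^^ i) (fst p)) ((T ^^ i) (snd p))) \<in> borel_measurable (\<mu> \<Otimes>\<^sub>M \<mu>)"
proof -
  have "(\<lambda>p. ((T ^^ i) (fst p), (T ^^ i) (snd p))) \<in> measurable (\<mu> \<Otimes>\<^sub>M \<mu>) (\<mu> \<Otimes>\<^sub>M \<mu>)"
    by measurable
  from measurable_compose[OF this dist_measurable_pair] show ?thesis by simp
qed

lemma S_sets: "S X T \<epsilon> \<in> sets (\<mu> \<Otimes>\<^sub>M \<mu>)"
proof -
  have "S X T \<epsilon> = {p \<in> space (\<mu> \<Otimes>\<^sub>M \<mu>).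
      \<exists>n\<in>{0<..}. \<epsilon> \<le> dist ((T ^^ n) (fst p)) ((T ^^ n) (snd p))}"
    by (auto simp: S_def space_pair_measure space_eq)
  also have "\<dots> \<in> sets (\<mu> \<Otimes>\<^sub>M \<mu>)"
    by measurable
  finally show ?thesis .
qed

section \<open>Orbit balls\<close>

text \<open>Real radii can be added in the triangle inequality, and countably many bounds in place
  of a supremum make measurability direct.\<close>

definition oball :: "real \<Rightarrow> 'a \<Rightarrow> 'a set" where
  "oball r x = {y \<in> X. \<forall>i. dist ((T ^^ i) x) ((T ^^ i) y) \<le> r}"

text \<open>All distances along the two orbits are at most the diameter of the compact set
  \<open>X\<close>, so the real supremum is bounded by \<open>r\<close> exactly when every term
  is.\<close>

lemma orbit_ball_eq:
  assumes "x \<in> X" shows "orbit_ball X T m x = oball (1 / real m) x"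
proof -
  have "orbit_dist T x y \<le> r \<longleftrightarrow> (\<forall>i. dist ((T ^^ i) x) ((T ^^ i) y) \<le> r)" if "y \<in> X" for y r
  proof -
    have "bdd_above (range (\<lambda>i. dist ((T ^^ i) x) ((T ^^ i) y)))"
      using funpow_maps[OF assms] funpow_maps[OF that]
        diameter_bounded_bound[OF compact_imp_bounded[OF compact_X]]
      by (intro bdd_aboveI[of _ "diameter X"]) auto
    then show ?thesis
      by (simp add: orbit_dist_def cSUP_le_iff)
  qed
  then show ?thesis by (auto simp: orbit_ball_def oball_def)
qed

lemma oball_trans:
  assumes "y \<in> oball r x" "z \<in> oball s y" shows "z \<in> oball (r + s) x"
proof -
  have "dist ((T ^^ i) x) ((T ^^ i) z) \<le> r + s" for i
    using assms by (intro order_trans[OF dist_triangle[of _ _ "(T ^^ i) y"]] add_mono)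
      (auto simp: oball_def)
  then show ?thesis using assms(2) by (simp add: oball_def)
qed

lemma oball_sym: "x \<in> X \<Longrightarrow> y \<in> oball r x \<Longrightarrow> x \<in> oball r y"
  by (auto simp: oball_def dist_commute)

text \<open>Orbit balls are the sections of this set, which yields both their measurability and that
  of their measure as a function of the centre.\<close>

lemma oball_pairs_sets: "{p \<in> space (\<mu> \<Otimes>\<^sub>M \<mu>). snd p \<in> oball r (fst p)} \<in> sets (\<mu> \<Otimes>\<^sub>M \<mu>)"
proof -
  have "{p \<in> space (\<mu> \<Otimes>\<^sub>M \<mu>). snd p \<in> oball r (fst p)} = {p \<in> space (\<mu> \<Otimes>\<^sub>M \<mu>).
      \<forall>i. dist ((T ^^ i) (fst p)) ((T ^^ i) (snd p)) \<le> r}"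
    by (auto simp: oball_def space_pair_measure space_eq)
  also have "\<dots> \<in> sets (\<mu> \<Otimes>\<^sub>M \<mu>)" by measurable
  finally show ?thesis .
qed

lemma oball_section:
  assumes "x \<in> X"
  shows "oball r x = Pair x -` {p \<in> space (\<mu> \<Otimes>\<^sub>M \<mu>). snd p \<in> oball r (fst p)}"
  using assms by (auto simp: oball_def space_pair_measure space_eq)

lemma oball_sets: "x \<in> X \<Longrightarrow> oball r x \<in> sets \<mu>"
  using sets_Pair1[OF oball_pairs_sets, of x r] by (simp only: oball_section[symmetric])

lemma measure_oball_measurable: "(\<lambda>x. measure \<mu> (oball r x)) \<in> borel_measurable \<mu>"
proof -
  have "(\<lambda>x. measure \<mu> (Pair x -` {p \<in> space (\<mu> \<Otimes>\<^sub>M \<mu>). snd p \<in> oball r (fst p)}))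
      \<in> borel_measurable \<mu>"
    unfolding measure_def
    using measurable_emeasure_Pair[OF oball_pairs_sets, of r] by measurable
  then show ?thesis
    by (rule measurable_cong[THEN iffD1, rotated]) (simp only: oball_section[symmetric] space_eq)
qed

section \<open>Ergodicity and orbit balls of positive measure\<close>

text \<open>The iterated preimages of \<open>A\<close> increase and all have the measure of
  \<open>A\<close>. Their union is therefore of the same measure, and it is strictly invariant, so
  \<open>zero_one\<close> applies to it.\<close>

lemma zero_one_forward_invariant:
  assumes A: "A \<in> sets \<mu>" and fwd: "\<And>x. x \<in> A \<Longrightarrow> T x \<in> A"
  shows "measure \<mu> A = 0 \<or> measure \<mu> A = 1"
proof -
  define B where "B n = (T ^^ n) -` A \<inter> X" for n
  have B_sets: "B n \<in> sets \<mu>" for n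
    using measurable_sets[OF funpow_measurable A] by (simp add: B_def space_eq)
  have B_Suc: "B (Suc n) = T -` B n \<inter> X" for n
    by (auto simp: B_def T_maps funpow_swap1)
  have "A \<subseteq> X" using sets.sets_into_space[OF A] space_eq by simp
  then have "measure \<mu> (B n) = measure \<mu> A" for n
  proof (induction n)
    case 0
    then show ?case by (simp add: B_def Int_absorb2)
  next
    case (Suc n)
    then show ?case using measure_vimage_T[OF B_sets] by (simp add: B_Suc)
  qed
  moreover have inc: "B n \<subseteq> B (Suc n)" for n
    using fwd by (auto simp: B_def)
  then have "(\<lambda>n. measure \<mu> (B n)) \<longlonglongrightarrow> measure \<mu> (\<Union>n. B n)"
    using B_sets by (intro finite_Lim_measure_incseq) (auto intro: incseq_SucI)
  ultimately have "measure \<mu> (\<Union>n. B n) = measure \<mu> A"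
    by (simp add: LIMSEQ_const_iff)
  moreover have "T -` (\<Union>n. B n) \<inter> X = (\<Union>n. B n)"
  proof -
    \<comment> \<open>The preimage shifts the index, and losing \<open>B 0\<close> does not matter
      since \<open>B 0 \<subseteq> B 1\<close>.\<close>
    have "T -` (\<Union>n. B n) \<inter> X = (\<Union>n. B (Suc n))" by (auto simp: B_Suc)
    also have "\<dots> = (\<Union>n. B n)" using inc by blast
    finally show ?thesis .
  qed
  ultimately show ?thesis
    using zero_one[of "\<Union>n. B n"] B_sets by auto
qed

text \<open>The set \<open>S\<close> only tests times \<open>n > 0\<close>, so a pair outside it is
  controlled from time 1 on. This bounds the orbits of \<open>T x\<close> and \<open>T y\<close>,
  but not the distance of \<open>x\<close> and \<open>y\<close> themselves.\<close>

lemma section_compl_S_subset: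
  assumes "x \<in> X"
  shows "Pair x -` (X \<times> X - S X T r) \<subseteq> T -` oball r (T x) \<inter> X"
proof
  fix y assume "y \<in> Pair x -` (X \<times> X - S X T r)"
  then have "y \<in> X" and "(x, y) \<notin> S X T r" by auto
  then have y: "y \<in> X" "\<not> (\<exists>n>0. r \<le> dist ((T ^^ n) x) ((T ^^ n) y))"
    using assms by (simp_all add: S_def)
  have "dist ((T ^^ i) (T x)) ((T ^^ i) (T y)) \<le> r" for i
    using y(2) unfolding not_ex by (metis comp_apply funpow_Suc_right linear zero_less_Suc)
  then show "y \<in> T -` oball r (T x) \<inter> X"
    using y(1) by (simp add: oball_def T_maps)
qed

text \<open>The set \<open>A\<close> of good centres is mapped into itself by \<open>T\<close>, so
  it has measure 0 or 1. If it were null, almost all sections of the complement of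
  \<open>S X T r\<close> would be null, and \<open>r\<close> would witness sensitivity.\<close>

lemma AE_oball_pos:
  assumes ns: "\<not> sensitive X T \<mu>" and r: "r > 0"
  shows "AE x in \<mu>. measure \<mu> (oball r x) > 0"
proof -
  define A where "A = {x \<in> X. measure \<mu> (oball r x) > 0}"
  have A: "A \<in> sets \<mu>"
    using measurable_sets[OF measure_oball_measurable, of "{0<..}" r]
    by (simp add: A_def vimage_def space_eq Int_def conj_commute)
  have fwd: "T x \<in> A" if "x \<in> A" for x
  proof -
    have x: "x \<in> X" "measure \<mu> (oball r x) > 0" using that by (auto simp: A_def)
    have "oball r x \<subseteq> T -` oball r (T x) \<inter> X"
    proof
      fix y assume y: "y \<in> oball r x"
      have "dist ((T ^^ i) (T x)) ((T ^^ i) (T y)) \<le> r" for i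
        using y unfolding oball_def mem_Collect_eq by (metis comp_apply funpow_Suc_right)
      then show "y \<in> T -` oball r (T x) \<inter> X"
        using y by (simp add: oball_def T_maps)
    qed
    then have "measure \<mu> (oball r x) \<le> measure \<mu> (T -` oball r (T x) \<inter> X)"
      using measurable_sets[OF T_measurable oball_sets[OF T_maps[OF x(1)]]]
      by (intro finite_measure_mono) (auto simp: space_eq)
    also have "\<dots> = measure \<mu> (oball r (T x))"
      by (intro measure_vimage_T oball_sets T_maps x)
    finally show ?thesis using x T_maps by (simp add: A_def)
  qed
  have "measure \<mu> A \<noteq> 0"
  proof
    assume "measure \<mu> A = 0"
    \<comment> \<open>The preimage is taken because the sections at \<open>x\<close> are controlled
      by the ball around \<open>T x\<close>.\<close>
    then have "T -` A \<inter> X \<in> null_sets \<mu>"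
      using measure_vimage_T[OF A] measurable_sets[OF T_measurable A]
      by (auto simp: space_eq null_sets_def emeasure_eq_measure)
    then have "AE x in \<mu>. x \<notin> T -` A \<inter> X" by (rule AE_not_in)
    then have "AE x in \<mu>. emeasure \<mu> (Pair x -` (X \<times> X - S X T r)) = 0"
    proof (eventually_elim)
      case (elim x)
      show ?case
      proof (cases "x \<in> X")
        case True
        have "measure \<mu> (T -` oball r (T x) \<inter> X) = 0"
          using True elim T_maps[OF True] measure_vimage_T[OF oball_sets[OF T_maps[OF True]], of r]
          by (auto simp: A_def not_less intro: antisym)
        then have "emeasure \<mu> (T -` oball r (T x) \<inter> X) = 0"
          by (simp add: emeasure_eq_measure)
        then show ?thesis
          using emeasure_mono[OF section_compl_S_subset[OF True]]
            measurable_sets[OF T_measurable oball_sets[OF T_maps[OF True]]]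
          by (metis le_zero_eq space_eq)
      next
        case False
        then have "Pair x -` (X \<times> X - S X T r) = {}" by auto
        then show ?thesis by simp
      qed
    qed
    \<comment> \<open>Fubini's theorem: the product measure is the integral of the measures of the
      sections.\<close>
    then have "emeasure (\<mu> \<Otimes>\<^sub>M \<mu>) (X \<times> X - S X T r) = 0"
      using S_sets[of r]
      by (subst emeasure_pair_measure_alt)
        (auto simp: nn_integral_0_iff_AE measurable_emeasure_Pair sets.Diff sets.top
          simp flip: space_eq space_pair_measure)
    then have "square.prob (space (\<mu> \<Otimes>\<^sub>M \<mu>) - S X T r) = 0"
      by (simp add: space_pair_measure space_eq measure_def)
    then have "square.prob (S X T r) = 1"
      using square.prob_compl[OF S_sets, of r] by simp
    then show False using ns r by (auto simp: sensitive_def)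
  qed
  then have "measure \<mu> A = 1"
    using zero_one_forward_invariant[OF A fwd] by blast
  then have "AE x in \<mu>. x \<in> A" using prob_eq_1[OF A] by simp
  then show ?thesis by eventually_elim (simp add: A_def)
qed

section \<open>Countable covers by orbit balls\<close>

text \<open>By maximality the \<open>r\<close>-ball of a good centre \<open>x\<close> meets that of
  some \<open>c \<in> C\<close>; a common point puts \<open>x\<close> within orbit distance
  \<open>2 * r\<close> of \<open>c\<close>.\<close>

lemma countable_cover:
  assumes "AE x in \<mu>. measure \<mu> (oball r x) > 0"
  obtains C where "countable C" "C \<subseteq> X" "AE x in \<mu>. \<exists>c\<in>C. x \<in> oball (2 * r) c"
proof -
  define I where "I = {x \<in> X. measure \<mu> (oball r x) > 0}"
  obtain C where C: "C \<subseteq> I" "disjoint_family_on (oball r) C"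
    and max: "\<And>i. i \<in> I \<Longrightarrow> i \<notin> C \<Longrightarrow> \<exists>c\<in>C. oball r i \<inter> oball r c \<noteq> {}"
    using maximal_disjoint_subfamily[of I "oball r"] by blast
  have "countable C"
    using C by (intro countable_disjoint_positive_measure[of "oball r"])
      (auto simp: I_def intro: oball_sets)
  moreover have "C \<subseteq> X" using C(1) by (auto simp: I_def)
  moreover have cover: "\<exists>c\<in>C. x \<in> oball (2 * r) c" if x: "x \<in> I" for x
  proof -
    \<comment> \<open>Nonemptiness settles the case \<open>x \<in> C\<close>, where \<open>x\<close>
      itself serves as \<open>c\<close>.\<close>
    have ne: "oball r x \<noteq> {}" using x by (auto simp: I_def)
    then have "\<exists>c\<in>C. oball r x \<inter> oball r c \<noteq> {}"
      using max[OF x] by (cases "x \<in> C") auto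
    then obtain c y where "c \<in> C" "y \<in> oball r x" "y \<in> oball r c" by blast
    moreover have "x \<in> X" using x by (simp add: I_def)
    ultimately show ?thesis
      using oball_trans[of y r c x r] oball_sym[of x y r] by auto
  qed
  moreover have "AE x in \<mu>. \<exists>c\<in>C. x \<in> oball (2 * r) c"
    using assms AE_space by eventually_elim (auto simp: I_def space_eq intro!: cover)
  ultimately show thesis using that by blast
qed

section \<open>Density points and existence of equicontinuity points\<close>

lemma Bn_sets: "Bn X n x \<in> sets \<mu>"
proof -
  have "Bn X n x = {y \<in> space \<mu>. dist y x \<le> 1 / real n}"
    by (auto simp: Bn_def space_eq dist_commute)
  also have "\<dots> \<in> sets \<mu>" by measurable
  finally show ?thesis .
qed

text \<open>At a density point of \<open>X\<close> the quotient is eventually positive. As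
  \<open>0 / 0 = 0\<close>, balls of large index then have positive measure, and so do the larger
  balls containing them.\<close>

lemma AE_Bn_pos:
  assumes "lebesgue_density X \<mu>"
  shows "AE x in \<mu>. \<forall>n\<ge>1. measure \<mu> (Bn X n x) > 0"
proof -
  have "AE x in \<mu>. x \<in> X \<longrightarrow>
      (\<lambda>n. measure \<mu> (X \<inter> Bn X n x) / measure \<mu> (Bn X n x)) \<longlonglongrightarrow> 1"
    using assms sets.top[of \<mu>] by (auto simp: lebesgue_density_def space_eq)
  then show ?thesis
    using AE_space
  proof eventually_elim
    case (elim x)
    then have "(\<lambda>n. measure \<mu> (X \<inter> Bn X n x) / measure \<mu> (Bn X n x)) \<longlonglongrightarrow> 1"
      by (simp add: space_eq)
    from order_tendstoD(1)[OF this zero_less_one] obtain N where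
      N: "\<And>n. n \<ge> N \<Longrightarrow> measure \<mu> (X \<inter> Bn X n x) / measure \<mu> (Bn X n x) > 0"
      by (auto simp: eventually_sequentially)
    show ?case
    proof (intro allI impI)
      fix n :: nat assume n: "n \<ge> 1"
      \<comment> \<open>This needs \<open>n \<ge> 1\<close>, since
        \<open>1 / real 0 = 0\<close>.\<close>
      have "1 / real (max n N) \<le> 1 / real n"
        using n by (intro divide_left_mono) auto
      then have "Bn X (max n N) x \<subseteq> Bn X n x" by (auto simp: Bn_def)
      then have "measure \<mu> (Bn X (max n N) x) \<le> measure \<mu> (Bn X n x)"
        by (intro finite_measure_mono Bn_sets)
      moreover have "measure \<mu> (Bn X (max n N) x) > 0"
        using N[of "max n N"] by (auto simp: zero_less_divide_iff not_less measure_le_0_iff)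
      ultimately show "measure \<mu> (Bn X n x) > 0" by simp
    qed
  qed
qed

lemma AE_orbit_ball_density:
  assumes ns: "\<not> sensitive X T \<mu>" and ld: "lebesgue_density X \<mu>" and m: "m \<ge> 1"
  shows "AE x in \<mu>.
    (\<lambda>n. measure \<mu> (orbit_ball X T m x \<inter> Bn X n x) / measure \<mu> (Bn X n x)) \<longlonglongrightarrow> 1"
proof -
  \<comment> \<open>The cover has radius \<open>2 * r\<close>, and recentring a covering ball at one
    of its points doubles this to \<open>1 / m\<close>.\<close>
  define r where "r = 1 / (4 * real m)"
  have r: "r > 0" "2 * r + 2 * r = 1 / real m" using m by (auto simp: r_def)
  obtain C where C: "countable C" "C \<subseteq> X" "AE x in \<mu>. \<exists>c\<in>C. x \<in> oball (2 * r) c"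
    using countable_cover[OF AE_oball_pos[OF ns r(1)]] by blast
  have "AE x in \<mu>. x \<in> oball (2 * r) c \<longrightarrow>
      (\<lambda>n. measure \<mu> (oball (2 * r) c \<inter> Bn X n x) / measure \<mu> (Bn X n x)) \<longlonglongrightarrow> 1" if "c \<in> C" for c
    using ld oball_sets[of c] that C(2) by (auto simp: lebesgue_density_def)
  \<comment> \<open>Countability of \<open>C\<close> keeps the union of the exceptional sets
    null.\<close>
  then have "AE x in \<mu>. \<forall>c\<in>C. x \<in> oball (2 * r) c \<longrightarrow>
      (\<lambda>n. measure \<mu> (oball (2 * r) c \<inter> Bn X n x) / measure \<mu> (Bn X n x)) \<longlonglongrightarrow> 1"
    using C(1) by (simp add: AE_ball_countable)
  then show ?thesis
    using C(3) AE_space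
  proof eventually_elim
    case (elim x)
    then have x: "x \<in> X" by (simp add: space_eq)
    obtain c where c: "c \<in> C" "x \<in> oball (2 * r) c" using elim(2) by blast
    then have lim: "(\<lambda>n. measure \<mu> (oball (2 * r) c \<inter> Bn X n x) / measure \<mu> (Bn X n x)) \<longlonglongrightarrow> 1"
      using elim(1) by blast
    have sub: "oball (2 * r) c \<subseteq> orbit_ball X T m x"
      using c C(2) oball_sym[of c x] oball_trans[of c "2 * r" x _ "2 * r"]
      by (auto simp: orbit_ball_eq[OF x] r(2))
    have ob: "orbit_ball X T m x \<in> sets \<mu>"
      using oball_sets[OF x] by (simp add: orbit_ball_eq[OF x])
    show ?case
    proof (rule tendsto_sandwich[OF _ _ lim tendsto_const])
      show "\<forall>\<^sub>F n in sequentially.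
          measure \<mu> (oball (2 * r) c \<inter> Bn X n x) / measure \<mu> (Bn X n x)
          \<le> measure \<mu> (orbit_ball X T m x \<inter> Bn X n x) / measure \<mu> (Bn X n x)"
        using sub ob Bn_sets
        by (intro always_eventually allI divide_right_mono finite_measure_mono) auto
      show "\<forall>\<^sub>F n in sequentially.
          measure \<mu> (orbit_ball X T m x \<inter> Bn X n x) / measure \<mu> (Bn X n x) \<le> 1"
        using Bn_sets
        by (intro always_eventually allI divide_le_eq_1[THEN iffD2])
          (auto simp: zero_less_measure_iff intro: finite_measure_mono)
    qed
  qed
qed

lemma equicontinuity_point_exists:
  assumes "\<not> sensitive X T \<mu>" "lebesgue_density X \<mu>"
  shows "\<exists>x\<in>X. equicontinuity_point X T \<mu> x"
proof -
  have "AE x in \<mu>. \<forall>m\<in>{1..}.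
      (\<lambda>n. measure \<mu> (orbit_ball X T m x \<inter> Bn X n x) / measure \<mu> (Bn X n x)) \<longlonglongrightarrow> 1"
    using AE_orbit_ball_density[OF assms] by (simp add: AE_ball_countable)
  then have "AE x in \<mu>. equicontinuity_point X T \<mu> x"
    using AE_Bn_pos[OF assms(2)] AE_space
    by eventually_elim (simp add: equicontinuity_point_def space_eq)
  \<comment> \<open>A property holding almost everywhere for a probability measure has a
    witness.\<close>
  then have "\<exists>x. equicontinuity_point X T \<mu> x"
    using eventually_happens' ae_filter_bot by blast
  then show ?thesis by (auto simp: equicontinuity_point_def)
qed

section \<open>Equicontinuity points exclude sensitivity\<close>

text \<open>A small orbit ball \<open>B\<close> around \<open>x\<close> fills a positive proportion
  of some \<open>Bn X n x\<close>, so it has positive measure. Then \<open>B \<times> B\<close> has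
  positive product measure and lies outside \<open>S X T \<epsilon>\<close>.\<close>

lemma not_sensitive:
  assumes eq: "equicontinuity_point X T \<mu> x"
  shows "\<not> sensitive X T \<mu>"
proof
  assume "sensitive X T \<mu>"
  then obtain \<epsilon> where \<epsilon>: "\<epsilon> > 0" "square.prob (S X T \<epsilon>) = 1" by (auto simp: sensitive_def)
  have x: "x \<in> X" using eq by (simp add: equicontinuity_point_def)
  \<comment> \<open>Two points of \<open>B\<close> are at orbit distance at most twice the radius;
    strictness is required because \<open>S\<close> admits distance exactly
    \<open>\<epsilon>\<close>.\<close>
  obtain k where k: "1 / real (Suc k) < \<epsilon> / 2" using nat_approx_posE[of "\<epsilon> / 2"] \<epsilon>(1) by auto
  define B where "B = oball (1 / real (Suc k)) x"
  have B: "B \<in> sets \<mu>" using oball_sets[OF x] by (simp add: B_def)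
  have "(\<lambda>n. measure \<mu> (B \<inter> Bn X n x) / measure \<mu> (Bn X n x)) \<longlonglongrightarrow> 1"
    using eq unfolding B_def equicontinuity_point_def orbit_ball_eq[OF x, of "Suc k", symmetric]
    by simp
  from order_tendstoD(1)[OF this zero_less_one] obtain n where
    "measure \<mu> (B \<inter> Bn X n x) / measure \<mu> (Bn X n x) > 0"
    by (auto simp: eventually_sequentially)
  then have "measure \<mu> (B \<inter> Bn X n x) > 0"
    by (auto simp: zero_less_divide_iff not_less measure_le_0_iff)
  also have "measure \<mu> (B \<inter> Bn X n x) \<le> measure \<mu> B"
    using B by (intro finite_measure_mono) auto
  finally have pos: "measure \<mu> B > 0" .
  have "B \<times> B \<subseteq> space (\<mu> \<Otimes>\<^sub>M \<mu>) - S X T \<epsilon>"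
  proof
    fix p assume "p \<in> B \<times> B"
    then obtain y z where p: "p = (y, z)" "y \<in> B" "z \<in> B" by auto
    then have "z \<in> oball (1 / real (Suc k) + 1 / real (Suc k)) y"
      unfolding B_def using oball_trans oball_sym[OF x] by blast
    then have "dist ((T ^^ n) y) ((T ^^ n) z) < \<epsilon>" for n
      using k by (auto simp: oball_def intro: le_less_trans)
    then show "p \<in> space (\<mu> \<Otimes>\<^sub>M \<mu>) - S X T \<epsilon>"
      using p by (auto simp: S_def space_pair_measure space_eq B_def oball_def not_le)
  qed
  then have "square.prob (B \<times> B) \<le> square.prob (space (\<mu> \<Otimes>\<^sub>M \<mu>) - S X T \<epsilon>)"
    using S_sets by (intro square.finite_measure_mono) auto
  also have "\<dots> = 0" using square.prob_compl[OF S_sets, of \<epsilon>] \<epsilon>(2) by simp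
  finally show False
    using pos B
    by (simp add: measure_def emeasure_pair_measure_Times enn2real_mult mult_le_0_iff)
qed

end

theorem theorem30:
  fixes X :: "'a::metric_space set" and T :: "'a \<Rightarrow> 'a" and \<mu> :: "'a measure"
  assumes "TDS X T"
    and "borel_prob_on X \<mu>"
    and "ergodic \<mu> T"
    and "vitali X \<mu>"
    and "lebesgue_density X \<mu>"
  shows "sensitive X T \<mu> \<longleftrightarrow> \<not> (\<exists>x\<in>X. equicontinuity_point X T \<mu> x)"
proof -
  interpret ergodic_system X T \<mu> by standard (fact assms)+
  show ?thesis
    using equicontinuity_point_exists[OF _ assms(5)] not_sensitive by blast
qed

end
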